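(* There exists an absolute constant $C>0$ such that for every positive integer $n$, $$n\log n - C n \le s^*(n),$$ where $s^*(n)$ denotes the minimum number of edges of a graph (with no condition on its number of vertices) that contains every $n$-vertex tree as a subgraph, and $\log$ is the natural logarithm.
   Context: Graphs are finite, simple and undirected. A graph $G$ contains a tree $T$ as a subgraph if $G$ has a (not necessarily induced) subgraph isomorphic to $T$. For a positive integer $n$, $s^*(n)$ is the minimum of $|E(G)|$ over all graphs $G$, with any number of vertices, such that $G$ contains every tree on $n$ vertices as a subgraph. The symbol $\log$ denotes the natural logarithm. *)

theory Defs
  imports Complex_Main "Graph_Theory.Graph_Theory"
begin

text \<open>
  A finite simple undirected graph is a \<^const>\<open>pair_graph\<close>: finite vertex set, symmetric arc
  relation, no loops. The two arcs (u,v) and (v,u) together form one undirected edge.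
\<close>

definition uedges :: "'a pair_pre_digraph \<Rightarrow> 'a set set" where
  "uedges G = (\<lambda>(u, v). {u, v}) ` parcs G"

text \<open>
  The library notions \<^const>\<open>forest\<close> and \<^const>\<open>tree\<close> forbid directed cycles, so they exclude every
  symmetric digraph that has an arc: (u,v),(v,u) is a directed cycle of length 2. The cycles of a
  simple undirected graph are the directed cycles of length at least 3 of its symmetric digraph.
\<close>

definition undirected_tree :: "'a pair_pre_digraph \<Rightarrow> bool" where
  "undirected_tree T \<longleftrightarrow>
     pair_graph T \<and> Digraph_Component.connected (with_proj T) \<and>
     \<not> (\<exists>p. pre_digraph.cycle (with_proj T) p \<and> 3 \<le> length p)"

definition contains_copy :: "'a pair_pre_digraph \<Rightarrow> 'b pair_pre_digraph \<Rightarrow> bool" where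
  "contains_copy G T \<longleftrightarrow>
     (\<exists>H. pair_graph H \<and> subgraph (with_proj H) (with_proj G) \<and>
          digraph_iso (with_proj H) (with_proj T))"

text \<open>
  Up to isomorphism every finite graph has its vertices in \<^typ>\<open>nat\<close>, so both quantifiers over
  graphs below range over graphs on natural numbers.
\<close>

definition tree_universal :: "nat \<Rightarrow> nat pair_pre_digraph \<Rightarrow> bool" where
  "tree_universal n G \<longleftrightarrow>
     pair_graph G \<and>
     (\<forall>T :: nat pair_pre_digraph. undirected_tree T \<and> card (pverts T) = n \<longrightarrow> contains_copy G T)"

definition s_star :: "nat \<Rightarrow> nat" where
  "s_star n = (LEAST m. \<exists>G. tree_universal n G \<and> card (uedges G) = m)"

text \<open>The minimum is taken over a nonempty set: the complete graph on n vertices qualifies.\<close>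

lemma tree_universal_complete:
  "tree_universal n \<lparr>pverts = {..<n}, parcs = {(u, v). u < n \<and> v < n \<and> u \<noteq> v}\<rparr>"
  (is "tree_universal n ?K")
proof -
  have fin: "finite {(u, v). u < n \<and> v < n \<and> u \<noteq> v}"
    by (rule finite_subset[of _ "{..<n} \<times> {..<n}"]) auto
  have K: "pair_graph ?K"
    using fin by unfold_locales (auto simp: symmetric_def intro: symI)
  have "contains_copy ?K T" if T: "undirected_tree T" "card (pverts T) = n"
    for T :: "nat pair_pre_digraph"
  proof -
    interpret T: pair_graph T using T by (simp add: undirected_tree_def)
    obtain h where h: "bij_betw h (pverts T) {..<n}"
      using T(2) T.pair_finite_verts ex_bij_betw_finite_nat
      by (metis atLeast0LessThan)
    have inj: "inj_on h (pverts T)" and im: "h ` pverts T = {..<n}"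
      using h by (auto simp: bij_betw_def)
    define H where "H = \<lparr>pverts = {..<n}, parcs = map_prod h h ` parcs T\<rparr>"
    define f where "f = \<lparr>iso_verts = h, iso_arcs = map_prod h h, iso_head = snd, iso_tail = fst\<rparr>"
    have sub: "parcs H \<subseteq> parcs ?K"
    proof
      fix e assume "e \<in> parcs H"
      then obtain u v where e: "e = (h u, h v)" and uv: "(u, v) \<in> parcs T"
        by (auto simp: H_def)
      have "u \<in> pverts T" "v \<in> pverts T" "u \<noteq> v"
        using uv T.wellformed' T.pair_no_loops[OF uv] by auto
      then show "e \<in> parcs ?K" using e inj im by (auto dest: inj_onD)
    qed
    have symT: "(v, u) \<in> parcs T" if "(u, v) \<in> parcs T" for u v
      using T.pair_sym_arcs that by (auto simp: symmetric_def dest: symD)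
    have symH: "symmetric (with_proj H)"
      using symT by (force simp: symmetric_def H_def intro!: symI)
    have H: "pair_graph H"
      using sub symH T.pair_finite_arcs
      by unfold_locales (auto simp: H_def)
    have subgraph: "subgraph (with_proj H) (with_proj ?K)"
      using sub H K
      by (auto simp: subgraph_def compatible_def H_def wf_digraph_wp_iff pair_graph_def pair_digraph_def
          pair_fin_digraph_def)
    have injE: "inj_on (map_prod h h) (parcs T)"
      by (rule inj_on_subset[OF map_prod_inj_on[OF inj inj]]) (auto dest: T.wellformed')
    have "pre_digraph.digraph_isomorphism (with_proj T) f"
      using inj injE T.wf_digraph_axioms by (auto simp: pre_digraph.digraph_isomorphism_def f_def)
    moreover have "with_proj H = app_iso f (with_proj T)"
      by (auto simp: with_proj_def app_iso_def f_def H_def im)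
    ultimately have "digraph_iso (with_proj T) (with_proj H)"
      by (auto simp: digraph_iso_def)
    then have "digraph_iso (with_proj H) (with_proj T)"
      using digraph_iso_swap T.wf_digraph_axioms by blast
    then show ?thesis using H subgraph by (auto simp: contains_copy_def)
  qed
  then show ?thesis using K by (auto simp: tree_universal_def)
qed

end

theory Submission
  imports Defs "HOL-Analysis.Harmonic_Numbers"
begin

text \<open>
  Join \<^term>\<open>i + 1\<close> disjoint stars, each on about \<open>n / (i + 1)\<close> vertices, to a tree on
  \<^term>\<open>n\<close> vertices. Deleting any \<^term>\<open>i\<close> vertices leaves one of the stars intact. Hence a graph
  containing this tree still has a vertex of degree about \<open>n / (i + 1) - 1\<close> after any
  \<^term>\<open>i\<close> of its vertices have been deleted. Deleting such vertices one after the other for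
  \<open>i = 0, \<dots>, n - 1\<close> removes every edge at most once, so there are at least
  \<open>\<Sum>\<^sub>i (n / (i + 1) - 2) \<ge> n log n - 2 n\<close> edges.
\<close>

section \<open>Trees given by a parent function\<close>

text \<open>Vertex 0 is the root, so the guards give it no parent. Both orientations of each edge
  occur, as simple graphs are symmetric digraphs here.\<close>

definition parent_graph :: "nat \<Rightarrow> (nat \<Rightarrow> nat) \<Rightarrow> nat pair_pre_digraph" where
  "parent_graph n f = \<lparr>pverts = {..<n},
     parcs = {(u, v). u < n \<and> v < n \<and> (0 < u \<and> v = f u \<or> 0 < v \<and> u = f v)}\<rparr>"

lemma pverts_parent_graph [simp]: "pverts (parent_graph n f) = {..<n}"
  by (simp add: parent_graph_def)

lemma parcs_parent_graph_iff:
  "(u, v) \<in> parcs (parent_graph n f) \<longleftrightarrow>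
     u < n \<and> v < n \<and> (0 < u \<and> v = f u \<or> 0 < v \<and> u = f v)"
  by (simp add: parent_graph_def)

lemma pair_graph_parent_graph:
  assumes "\<And>m. 0 < m \<Longrightarrow> f m < m"
  shows "pair_graph (parent_graph n f)"
proof -
  have fin: "finite (parcs (parent_graph n f))"
    by (rule finite_subset[of _ "{..<n} \<times> {..<n}"]) (auto simp: parcs_parent_graph_iff)
  have sym: "symmetric (with_proj (parent_graph n f))"
    by (auto simp: parcs_parent_graph_iff symmetric_def intro!: symI)
  show ?thesis
  proof unfold_locales
    fix e assume e: "e \<in> parcs (parent_graph n f)"
    obtain u v where uv: "e = (u, v)" by (cases e)
    show "fst e \<in> pverts (parent_graph n f)" "snd e \<in> pverts (parent_graph n f)"
      using e by (simp_all add: uv parcs_parent_graph_iff)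
    show "fst e \<noteq> snd e"
      using e assms[of u] assms[of v] by (auto simp: uv parcs_parent_graph_iff)
  qed (use fin sym in simp_all)
qed

lemma pcas_append: "pcas u (p @ q) v \<longleftrightarrow> (\<exists>w. pcas u p w \<and> pcas w q v)"
  by (induction p arbitrary: u) auto

lemma pcas_end_in_heads: "pcas u p v \<Longrightarrow> p \<noteq> [] \<Longrightarrow> v \<in> snd ` set p"
proof (induction p arbitrary: u)
  case (Cons e p)
  then show ?case by (cases "p = []") auto
qed simp

text \<open>Turns the distinctness condition in \<open>cycle\<close> into distinctness of arc heads,
  which survives a rotation of the arc list.\<close>

lemma tl_pawalk_verts: "pcas u p v \<Longrightarrow> tl (pawalk_verts u p) = map snd p"
proof (induction p arbitrary: u)
  case (Cons e p)
  then show ?case by (cases p) auto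
qed simp

text \<open>The largest vertex of a cycle would have its parent as both neighbours on the cycle.\<close>

lemma parent_graph_no_long_cycle:
  assumes f: "\<And>m. 0 < m \<Longrightarrow> f m < m"
    and cyc: "pre_digraph.cycle (with_proj (parent_graph n f)) p"
  shows "length p < 3"
proof (rule ccontr)
  assume long: "\<not> length p < 3"
  obtain u where sub: "set p \<subseteq> parcs (parent_graph n f)" and cas: "pcas u p u"
    and dist: "distinct (tl (pawalk_verts u p))" and ne: "p \<noteq> []"
    using cyc by (auto simp: pre_digraph.cycle_def pre_digraph.awalk_def cas_with_proj_eq
        awalk_verts_with_proj_eq)
  have dist': "distinct (map snd p)"
    using dist tl_pawalk_verts[OF cas] by simp
  define m where "m = Max (snd ` set p)"
  have "m \<in> snd ` set p" using ne by (simp add: m_def)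
  then obtain a where "(a, m) \<in> set p" by force
  then obtain p1 p2 where p: "p = p1 @ (a, m) # p2" by (meson split_list)
  \<comment> \<open>Rotate the cycle to start at its largest vertex \<open>m\<close>; the arc
    \<open>(a, m)\<close> closes it.\<close>
  have rot: "pcas m (p2 @ p1) a"
    using cas unfolding p by (auto simp: pcas_append)
  \<comment> \<open>Here length at least 3 enters: some arc after \<open>e\<close> has head
    \<open>a\<close>, so the predecessor \<open>a\<close> of \<open>m\<close> differs from its
    successor \<open>snd e\<close>.\<close>
  have len: "2 \<le> length (p2 @ p1)" using long by (simp add: p)
  then obtain e r where er: "p2 @ p1 = e # r" by (cases "p2 @ p1") simp_all
  then have rne: "r \<noteq> []" using len by (auto simp del: length_append)
  have cas_r: "pcas (snd e) r a" and fst_e: "fst e = m" using rot er by auto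
  have a_in: "a \<in> snd ` set r" using pcas_end_in_heads[OF cas_r rne] .
  have set_p: "set p = insert (a, m) (insert e (set r))"
    using arg_cong[OF er, of set] by (auto simp: p)
  have "distinct (map snd (p2 @ p1))" using dist' by (auto simp: p)
  then have e_notin: "snd e \<notin> snd ` set r" by (simp add: er)
  have le: "x \<le> m" if "x \<in> snd ` set p" for x using that by (simp add: m_def)
  have "a \<le> m" "snd e \<le> m" using a_in le set_p by auto
  moreover have "(a, m) \<in> parcs (parent_graph n f)" "(m, snd e) \<in> parcs (parent_graph n f)"
    using sub fst_e by (auto simp: set_p)
  ultimately have "a = f m" "snd e = f m"
    using f[of a] f[of "snd e"] by (auto simp: parcs_parent_graph_iff)
  then show False using a_in e_notin by simp
qed

text \<open>Parents decrease, so iterating \<open>f\<close> leads every vertex to 0, which gives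
  connectedness.\<close>

lemma undirected_tree_parent_graph:
  assumes f: "\<And>m. 0 < m \<Longrightarrow> f m < m" and n: "0 < n"
  shows "undirected_tree (parent_graph n f)"
proof -
  let ?G = "with_proj (parent_graph n f)"
  interpret pair_graph "parent_graph n f"
    by (rule pair_graph_parent_graph[OF f])
  have reach0: "reachable ?G m 0" if "m < n" for m
    using that
  proof (induction m rule: less_induct)
    case (less m)
    show ?case
    proof (cases "m = 0")
      case True
      then show ?thesis using less.prems reachable_refl[of m] by simp
    next
      case False
      then have fm: "f m < m" using f by simp
      with less.prems False have "(m, f m) \<in> parcs (parent_graph n f)"
        by (simp add: parcs_parent_graph_iff)
      then show ?thesis
        using less.IH[OF fm] fm less.prems adj_reachable_trans by simp
    qed
  qed
  have "reachable ?G u v" if "u < n" "v < n" for u v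
    using reach0[OF that(1)] symmetric_reachable'[OF reach0[OF that(2)]]
    by (rule reachable_trans)
  then have "Digraph_Component.connected ?G"
    using n reachable_mk_symmetric_eq[OF sym_arcs] by (intro connectedI) auto
  then show ?thesis
    using parent_graph_no_long_cycle[OF f] pair_graph_parent_graph[OF f]
    by (simp add: undirected_tree_def not_le)
qed

section \<open>Embeddings\<close>

lemma contains_copy_embedding:
  assumes "contains_copy G T"
  obtains h where "inj_on h (pverts T)"
    and "\<And>u v. (u, v) \<in> parcs T \<Longrightarrow> (h u, h v) \<in> parcs G"
proof -
  obtain H where H: "pair_graph H" "subgraph (with_proj H) (with_proj G)"
    and iso: "digraph_iso (with_proj H) (with_proj T)"
    using assms by (auto simp: contains_copy_def)
  interpret H: pair_graph H by fact
  have "digraph_iso (with_proj T) (with_proj H)"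
    using digraph_iso_swap[OF H.wf_digraph_axioms iso] .
  then obtain f where f: "pre_digraph.digraph_isomorphism (with_proj T) f"
    and eq: "with_proj H = app_iso f (with_proj T)"
    by (auto simp: digraph_iso_def)
  have fst_f: "iso_tail f = fst" and snd_f: "iso_head f = snd"
    and arcs: "parcs H = iso_arcs f ` parcs T"
    using arg_cong[OF eq, of tail] arg_cong[OF eq, of head] arg_cong[OF eq, of arcs] by simp_all
  have inj: "inj_on (iso_verts f) (pverts T)"
    using f by (simp add: pre_digraph.digraph_isomorphism_def)
  have "(iso_verts f u, iso_verts f v) \<in> parcs G" if "(u, v) \<in> parcs T" for u v
  proof -
    \<comment> \<open>An isomorphism carries a separate arc map. As the tail and head maps of
      \<open>H\<close> are the projections, the vertex map determines it.\<close>
    have "iso_arcs f (u, v) = (iso_verts f u, iso_verts f v)"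
      using f that by (auto simp: pre_digraph.digraph_isomorphism_def fst_f snd_f prod_eq_iff)
    moreover have "iso_arcs f (u, v) \<in> parcs G"
      using that H(2) arcs by (auto simp: subgraph_def)
    ultimately show ?thesis by simp
  qed
  with inj show thesis using that by blast
qed

section \<open>The greedy deletion\<close>

text \<open>Each of the \<open>n div k\<close> full blocks of \<open>k\<close> consecutive numbers
  below \<open>n\<close> contains one member of the class.\<close>

lemma card_residue_class_ge:
  fixes k n c :: nat
  assumes "c < k"
  shows "n div k \<le> card {m. m < n \<and> m mod k = c}"
proof -
  have "(\<lambda>q. q * k + c) ` {..<n div k} \<subseteq> {m. m < n \<and> m mod k = c}"
  proof clarsimp
    fix q assume "q < n div k"
    then have "Suc q * k \<le> n div k * k" by (intro mult_le_mono) auto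
    also have "\<dots> \<le> n" by simp
    finally show "q * k + c < n \<and> c mod k = c" using assms by simp
  qed
  then have "card ((\<lambda>q. q * k + c) ` {..<n div k}) \<le> card {m. m < n \<and> m mod k = c}"
    by (rule card_mono[rotated]) simp
  moreover have "inj_on (\<lambda>q. q * k + c) {..<n div k}"
    using assms by (auto simp: inj_on_def)
  ultimately show ?thesis by (simp add: card_image)
qed

text \<open>
  The stars are the residue classes modulo \<^term>\<open>Suc (card S)\<close>, each centred at its least element;
  they are joined through \<^term>\<open>0::nat\<close>.
\<close>

lemma tree_universal_large_degree:
  assumes G: "tree_universal n G" and S: "finite S" "card S < n"
  shows "\<exists>v. v \<notin> S \<and> n div Suc (card S) - 1 \<le> card {w. (v, w) \<in> parcs G \<and> w \<notin> S}"
proof -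
  define k where "k = Suc (card S)"
  \<comment> \<open>Nonzero centres hang from 0; every \<open>m\<close> from \<open>k\<close> on
    hangs from the centre of its class.\<close>
  define f where "f m = (if m < k then 0 else m mod k)" for m
  have f: "f m < m" if "0 < m" for m
  proof (cases "m < k")
    case False
    then have "m mod k < k" by (simp add: k_def)
    with False show ?thesis by (simp add: f_def)
  qed (simp add: f_def that)
  have kn: "k \<le> n" using S by (simp add: k_def)
  have "contains_copy G (parent_graph n f)"
    using G undirected_tree_parent_graph[OF f, of n] kn
    by (auto simp: tree_universal_def k_def)
  then obtain h where inj: "inj_on h {..<n}"
    and hom: "\<And>u v. (u, v) \<in> parcs (parent_graph n f) \<Longrightarrow> (h u, h v) \<in> parcs G"
    by (rule contains_copy_embedding) simp
  interpret G: pair_graph G using G by (simp add: tree_universal_def)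
  define B where "B = {m. m < n \<and> h m \<in> S}"
  have "card B = card (h ` B)"
    by (rule card_image[symmetric]) (rule inj_on_subset[OF inj], auto simp: B_def)
  also have "\<dots> \<le> card S" using S by (intro card_mono) (auto simp: B_def)
  finally have "card ((\<lambda>m. m mod k) ` B) \<le> card S"
    using card_image_le[of B "\<lambda>m. m mod k"] by (simp add: B_def)
  \<comment> \<open>Pigeonhole: the vertices mapped into \<open>S\<close> meet at most
    \<open>card S = k - 1\<close> of the \<open>k\<close> classes, so some star avoids
    \<open>S\<close>.\<close>
  then have "\<not> {..<k} \<subseteq> (\<lambda>m. m mod k) ` B"
    using card_mono[of "(\<lambda>m. m mod k) ` B" "{..<k}"] by (auto simp: k_def B_def)
  then obtain c where c: "c < k" "c \<notin> (\<lambda>m. m mod k) ` B" by auto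
  define R where "R = {m. m < n \<and> m mod k = c}"
  have RS: "h m \<notin> S" if "m \<in> R" for m
    using c(2) that by (auto simp: R_def B_def)
  have cR: "c \<in> R" using c(1) kn by (simp add: R_def)
  have "h ` (R - {c}) \<subseteq> {w. (h c, w) \<in> parcs G \<and> w \<notin> S}"
  proof clarsimp
    fix m assume m: "m \<in> R" "m \<noteq> c"
    then have "k \<le> m" using mod_less[of m k] by (auto simp: R_def not_less[symmetric])
    then have "(c, m) \<in> parcs (parent_graph n f)"
      using m cR by (auto simp: parcs_parent_graph_iff R_def f_def k_def)
    then show "(h c, h m) \<in> parcs G \<and> h m \<notin> S" using hom RS m(1) by blast
  qed
  moreover have "finite {w. (h c, w) \<in> parcs G \<and> w \<notin> S}"
    by (rule finite_subset[OF _ G.pair_finite_verts]) (auto dest: G.wellformed')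
  ultimately have "card (h ` (R - {c})) \<le> card {w. (h c, w) \<in> parcs G \<and> w \<notin> S}"
    by (simp add: card_mono)
  \<comment> \<open>The subtracted 1 is the centre \<open>c\<close>, which is not its own
    neighbour.\<close>
  moreover have "card (h ` (R - {c})) = card R - 1"
    using card_image[OF inj_on_subset[OF inj, of "R - {c}"]] cR by (auto simp: R_def)
  moreover have "n div k \<le> card R"
    unfolding R_def by (rule card_residue_class_ge[OF c(1)])
  ultimately have "n div k - 1 \<le> card {w. (h c, w) \<in> parcs G \<and> w \<notin> S}" by linarith
  then show ?thesis using RS[OF cR] unfolding k_def by blast
qed

text \<open>\<open>S\<close> collects the deleted vertices. The edges from the next vertex
  \<open>v\<close> to vertices outside \<open>S\<close> are disjoint from \<open>S\<close>, so they
  have not been counted before.\<close>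

lemma tree_universal_edges_meeting:
  assumes G: "tree_universal n G" and "j \<le> n"
  shows "\<exists>S. finite S \<and> card S = j \<and>
    (\<Sum>i<j. n div Suc i - 1) \<le> card {e \<in> uedges G. e \<inter> S \<noteq> {}}"
  using \<open>j \<le> n\<close>
proof (induction j)
  case 0
  then show ?case by (intro exI[of _ "{}"]) simp
next
  case (Suc j)
  interpret G: pair_graph G using G by (simp add: tree_universal_def)
  have fin: "finite (uedges G)" using G.pair_finite_arcs by (simp add: uedges_def)
  obtain S where S: "finite S" "card S = j"
    and IH: "(\<Sum>i<j. n div Suc i - 1) \<le> card {e \<in> uedges G. e \<inter> S \<noteq> {}}"
    using Suc by auto
  obtain v where v: "v \<notin> S"
    and deg: "n div Suc j - 1 \<le> card {w. (v, w) \<in> parcs G \<and> w \<notin> S}"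
    using tree_universal_large_degree[OF G S(1)] S(2) Suc.prems by auto
  let ?N = "{w. (v, w) \<in> parcs G \<and> w \<notin> S}"
  let ?E = "\<lambda>S. {e \<in> uedges G. e \<inter> S \<noteq> {}}"
  have "inj_on (\<lambda>w. {v, w}) ?N" by (auto simp: inj_on_def doubleton_eq_iff)
  then have "card ((\<lambda>w. {v, w}) ` ?N) = card ?N" by (rule card_image)
  moreover have "finite ?N"
    by (rule finite_subset[OF _ G.pair_finite_verts]) (auto dest: G.wellformed')
  moreover have "(\<lambda>w. {v, w}) ` ?N \<inter> ?E S = {}" using v by auto
  ultimately have "card (?E S \<union> (\<lambda>w. {v, w}) ` ?N) = card (?E S) + card ?N"
    using fin by (subst card_Un_disjoint) auto
  moreover have "?E S \<union> (\<lambda>w. {v, w}) ` ?N \<subseteq> ?E (insert v S)"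
    by (auto simp: uedges_def image_iff)
  then have "card (?E S \<union> (\<lambda>w. {v, w}) ` ?N) \<le> card (?E (insert v S))"
    using fin by (intro card_mono) auto
  ultimately have "(\<Sum>i<Suc j. n div Suc i - 1) \<le> card (?E (insert v S))"
    using IH deg by simp
  moreover have "finite (insert v S)" "card (insert v S) = Suc j" using S v by auto
  ultimately show ?case by blast
qed

lemma tree_universal_card_uedges:
  assumes G: "tree_universal n G"
  shows "(\<Sum>i<n. n div Suc i - 1) \<le> card (uedges G)"
proof -
  obtain S where S: "(\<Sum>i<n. n div Suc i - 1) \<le> card {e \<in> uedges G. e \<inter> S \<noteq> {}}"
    using tree_universal_edges_meeting[OF G order.refl] by blast
  interpret G: pair_graph G using G by (simp add: tree_universal_def)
  have "card {e \<in> uedges G. e \<inter> S \<noteq> {}} \<le> card (uedges G)"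
    using G.pair_finite_arcs by (intro card_mono) (auto simp: uedges_def)
  with S show ?thesis by linarith
qed

text \<open>Each summand falls short of \<open>n / (i + 1)\<close> by at most 1 for rounding and 1
  for the centre, in total at most \<open>2 * n\<close>. The quotients sum to \<open>n\<close> times
  a harmonic number.\<close>

lemma sum_div_ge_ln:
  assumes "0 < n"
  shows "real n * ln (real n) - 2 * real n \<le> real (\<Sum>i<n. n div Suc i - 1)"
proof -
  have "real n / real (Suc i) - 2 \<le> real (n div Suc i - 1)" for i
  proof -
    have "real (n mod Suc i) / real (Suc i) \<le> 1"
      using mod_less_divisor[of "Suc i" n] by (simp del: mod_less_divisor)
    then show ?thesis using of_nat_of_nat_div_aux[of n "Suc i", where 'a = real] by linarith
  qed
  then have "(\<Sum>i<n. real n / real (Suc i) - 2) \<le> (\<Sum>i<n. real (n div Suc i - 1))"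
    by (intro sum_mono)
  also have "(\<Sum>i<n. real n / real (Suc i) - 2) = real n * harm n - 2 * real n"
    by (simp add: sum_subtractf harm_altdef sum_distrib_left divide_inverse)
  finally have "real n * harm n - 2 * real n \<le> real (\<Sum>i<n. n div Suc i - 1)" by simp
  \<comment> \<open>\<open>ln_le_harm\<close> concerns the logarithm of \<open>n + 1\<close>;
    monotonicity of \<open>ln\<close> does the rest.\<close>
  moreover have "ln (real n) \<le> harm n"
    using assms by (intro order_trans[OF _ ln_le_harm]) simp
  then have "real n * ln (real n) \<le> real n * harm n" by (simp add: mult_left_mono)
  ultimately show ?thesis by linarith
qed

theorem theorem1:
  shows "\<exists>C::real. C > 0 \<and>
           (\<forall>n::nat. n > 0 \<longrightarrow> real n * ln (real n) - C * real n \<le> real (s_star n))"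
proof (intro exI[of _ 2] conjI allI impI)
  fix n :: nat assume n: "n > 0"
  \<comment> \<open>The complete graph makes the set under \<open>LEAST\<close> nonempty, so
    \<open>s_star n\<close> is attained by some universal graph.\<close>
  have "\<exists>m G. tree_universal n G \<and> card (uedges G) = m"
    using tree_universal_complete by blast
  then have "\<exists>G. tree_universal n G \<and> card (uedges G) = s_star n"
    unfolding s_star_def by (rule LeastI_ex)
  then obtain G where "tree_universal n G" "card (uedges G) = s_star n" by blast
  then have "(\<Sum>i<n. n div Suc i - 1) \<le> s_star n"
    using tree_universal_card_uedges by metis
  then show "real n * ln (real n) - 2 * real n \<le> real (s_star n)"
    using sum_div_ge_ln[OF n] by linarith
qed simp

end
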